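(* Let $\alpha=\alpha_1\alpha_2\ldots$ be an infinite word over the alphabet $\{0,1,2\}$ containing the letter $2$ infinitely many times. Then the class $\mathcal{G}_\alpha$ has unbounded clique-width, i.e. there is no constant $c$ such that every graph in $\mathcal{G}_\alpha$ has clique-width at most $c$.
   Context: Graphs are undirected, without loops or multiple edges. The clique-width of a finite graph $G$ is the minimum number of labels needed to construct $G$ by an expression using the following operations: creation of a new vertex with label $i$; disjoint union of two labelled graphs; $\eta_{i,j}$ ($i\neq j$), adding all edges between vertices labelled $i$ and vertices labelled $j$; $\rho_{i\to j}$, renaming label $i$ to label $j$. Let $\mathbb{N}=\{1,2,\ldots\}$. For an infinite word $\alpha=\alpha_1\alpha_2\ldots$ over $\{0,1,2\}$, the graph $\mathcal{P}^\alpha$ has vertex set $\{v_{i,j}: i,j\in\mathbb{N}\}$ (with $V_j=\{v_{i,j}: i\in\mathbb{N}\}$ the $j$th column); its only edges are between consecutive columns, and $v_{i,j}\in V_j$ is adjacent to $v_{k,j+1}\in V_{j+1}$ iff: $i=k$, when $\alpha_j=0$; $i\neq k$, when $\alpha_j=1$; $i\leq k$, when $\alpha_j=2$. The class $\mathcal{G}_\alpha$ consists of all finite induced subgraphs of $\mathcal{P}^\alpha$ (up to isomorphism). *)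

theory Defs
  imports "Graph_Theory.Graph_Theory"
begin

text \<open>
  Undirected graphs are symmetric loop-free pair digraphs, as in the locale
  \<^locale>\<open>pair_graph\<close>: an edge between \<open>u\<close> and \<open>v\<close> is the pair of arcs \<open>(u, v)\<close>, \<open>(v, u)\<close>.
\<close>

section \<open>Clique-width\<close>

text \<open>
  An expression names the vertices that it creates, so that it denotes a concrete
  graph and not only an isomorphism type.
\<close>

datatype 'v cw_expr =
    Create 'v nat
  | Disj_Union "'v cw_expr" "'v cw_expr"
  | Eta nat nat "'v cw_expr"
  | Rho nat nat "'v cw_expr"

primrec cw_verts :: "'v cw_expr \<Rightarrow> 'v set" where
  "cw_verts (Create v i) = {v}"
| "cw_verts (Disj_Union e f) = cw_verts e \<union> cw_verts f"
| "cw_verts (Eta i j e) = cw_verts e"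
| "cw_verts (Rho i j e) = cw_verts e"

text \<open>The final label of each vertex (meaningful only on \<^const>\<open>cw_verts\<close>).\<close>

primrec cw_label :: "'v cw_expr \<Rightarrow> 'v \<Rightarrow> nat" where
  "cw_label (Create v i) = (\<lambda>_. i)"
| "cw_label (Disj_Union e f) = (\<lambda>v. if v \<in> cw_verts e then cw_label e v else cw_label f v)"
| "cw_label (Eta i j e) = cw_label e"
| "cw_label (Rho i j e) = (\<lambda>v. if cw_label e v = i then j else cw_label e v)"

primrec cw_arcs :: "'v cw_expr \<Rightarrow> 'v rel" where
  "cw_arcs (Create v i) = {}"
| "cw_arcs (Disj_Union e f) = cw_arcs e \<union> cw_arcs f"
| "cw_arcs (Eta i j e) = cw_arcs e \<union>
    {(u, v). u \<in> cw_verts e \<and> v \<in> cw_verts e \<and>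
      (cw_label e u = i \<and> cw_label e v = j \<or> cw_label e u = j \<and> cw_label e v = i)}"
| "cw_arcs (Rho i j e) = cw_arcs e"

definition cw_graph :: "'v cw_expr \<Rightarrow> 'v pair_pre_digraph" where
  "cw_graph e = \<lparr>pverts = cw_verts e, parcs = cw_arcs e\<rparr>"

primrec cw_valid :: "'v cw_expr \<Rightarrow> bool" where
  "cw_valid (Create v i) \<longleftrightarrow> True"
| "cw_valid (Disj_Union e f) \<longleftrightarrow> cw_valid e \<and> cw_valid f \<and> cw_verts e \<inter> cw_verts f = {}"
| "cw_valid (Eta i j e) \<longleftrightarrow> cw_valid e \<and> i \<noteq> j"
| "cw_valid (Rho i j e) \<longleftrightarrow> cw_valid e"

primrec cw_labels :: "'v cw_expr \<Rightarrow> nat set" where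
  "cw_labels (Create v i) = {i}"
| "cw_labels (Disj_Union e f) = cw_labels e \<union> cw_labels f"
| "cw_labels (Eta i j e) = {i, j} \<union> cw_labels e"
| "cw_labels (Rho i j e) = {i, j} \<union> cw_labels e"

text \<open>
  No expression denotes the empty graph; its clique-width is 0 by convention.
  For all other finite graphs the minimum is over a nonempty set
  (\<open>cw_expr_exists\<close> below).
\<close>

definition clique_width :: "'v pair_pre_digraph \<Rightarrow> nat" where
  "clique_width G =
    (if pverts G = {} then 0
     else LEAST k. \<exists>e. cw_valid e \<and> cw_graph e = G \<and> card (cw_labels e) = k)"

lemma finite_cw_labels: "finite (cw_labels e)"
  by (induction e) auto

lemma pair_graph_cw_graph:
  assumes "cw_valid e"
  shows "pair_graph (cw_graph e)"
proof -
  have fin: "finite (cw_verts e)"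
    by (induction e) auto
  have sub: "cw_arcs e \<subseteq> cw_verts e \<times> cw_verts e"
    by (induction e) auto
  have sym: "sym (cw_arcs e)"
    by (induction e) (auto simp: sym_def)
  have irr: "cw_arcs e \<subseteq> {(u, v). u \<noteq> v}"
    using assms by (induction e) auto
  show ?thesis
    using fin sub sym irr finite_subset[OF sub]
    by unfold_locales (auto simp: cw_graph_def symmetric_def)
qed

lemma cw_expr_exists:
  assumes "pair_graph G" and "pverts G \<noteq> {}"
  shows "\<exists>e. cw_valid e \<and> cw_graph e = G"
proof -
  interpret pair_graph G by fact
  have "finite (pverts G)" by simp
  then obtain l :: "'a \<Rightarrow> nat" where l: "inj_on l (pverts G)"
    using finite_imp_inj_to_nat_seg by metis
  have "\<exists>e. cw_valid e \<and> cw_verts e = V \<and> cw_arcs e = {} \<and> (\<forall>v\<in>V. cw_label e v = l v)"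
    if "finite V" "V \<noteq> {}" for V
    using that
  proof (induction V rule: finite_ne_induct)
    case (singleton x)
    then show ?case by (intro exI[of _ "Create x (l x)"]) auto
  next
    case (insert x F)
    then obtain e where "cw_valid e" "cw_verts e = F" "cw_arcs e = {}"
      "\<forall>v\<in>F. cw_label e v = l v" by auto
    with insert show ?case
      by (intro exI[of _ "Disj_Union (Create x (l x)) e"]) auto
  qed
  from this[OF \<open>finite (pverts G)\<close> assms(2)] obtain e0 where e0: "cw_valid e0"
    "cw_verts e0 = pverts G" "cw_arcs e0 = {}" "\<forall>v\<in>pverts G. cw_label e0 v = l v"
    by auto
  have "\<exists>e. cw_valid e \<and> cw_verts e = pverts G \<and> cw_arcs e = A \<union> A\<inverse> \<and>
      (\<forall>v\<in>pverts G. cw_label e v = l v)"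
    if "finite A" "A \<subseteq> parcs G" for A
    using that
  proof (induction A rule: finite_induct)
    case empty
    then show ?case using e0 by auto
  next
    case (insert a A)
    then obtain e where e: "cw_valid e" "cw_verts e = pverts G" "cw_arcs e = A \<union> A\<inverse>"
      "\<forall>v\<in>pverts G. cw_label e v = l v" by auto
    obtain u v where a: "a = (u, v)" by force
    have uv: "u \<in> pverts G" "v \<in> pverts G" "u \<noteq> v"
      using insert.prems a in_arcsD1 in_arcsD2 pair_no_loops by fastforce+
    then have "l u \<noteq> l v" using l by (auto dest: inj_onD)
    moreover have "x = y" if "x \<in> pverts G" "y \<in> pverts G" "l x = l y" for x y
      using that l by (auto dest: inj_onD)
    ultimately show ?case using e uv a
      by (intro exI[of _ "Eta (l u) (l v) e"]) auto
  qed
  from this[of "parcs G"] obtain e where e: "cw_valid e" "cw_verts e = pverts G"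
    "cw_arcs e = parcs G \<union> (parcs G)\<inverse>"
    using pair_finite_arcs by auto
  have "(parcs G)\<inverse> = parcs G"
    using pair_sym_arcs by (simp add: symmetric_def sym_conv_converse_eq)
  with e show ?thesis by (intro exI[of _ e]) (simp add: cw_graph_def)
qed


section \<open>The graph of a word and its class of finite induced subgraphs\<close>

text \<open>
  The letters of the word are \<open>\<alpha> 1, \<alpha> 2, \<dots>\<close>; the value \<open>\<alpha> 0\<close> is never used.
  The vertex in row \<open>i\<close> of column \<open>j\<close> is \<open>(i, j)\<close>.
\<close>

definition word_edge :: "(nat \<Rightarrow> nat) \<Rightarrow> nat \<times> nat \<Rightarrow> nat \<times> nat \<Rightarrow> bool" where
  "word_edge \<alpha> = (\<lambda>(i, j) (k, m). m = j + 1 \<and>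
     (\<alpha> j = 0 \<and> i = k \<or> \<alpha> j = 1 \<and> i \<noteq> k \<or> \<alpha> j = 2 \<and> i \<le> k))"

definition word_graph :: "(nat \<Rightarrow> nat) \<Rightarrow> (nat \<times> nat) pair_pre_digraph" where
  "word_graph \<alpha> =
    \<lparr>pverts = {1..} \<times> {1..},
     parcs = {(u, v). u \<in> {1..} \<times> {1..} \<and> v \<in> {1..} \<times> {1..} \<and>
       (word_edge \<alpha> u v \<or> word_edge \<alpha> v u)}\<rparr>"

text \<open>
  Closed under isomorphism within the vertex type \<^typ>\<open>nat \<times> nat\<close>, which is infinite
  and hence carries a copy of every finite graph.
\<close>

definition word_class :: "(nat \<Rightarrow> nat) \<Rightarrow> (nat \<times> nat) pair_pre_digraph set" where
  "word_class \<alpha> =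
    {G. \<exists>H :: (nat \<times> nat) pair_pre_digraph.
       induced_subgraph (with_proj H) (with_proj (word_graph \<alpha>)) \<and> finite (pverts H) \<and>
       digraph_iso (with_proj G) (with_proj H)}"

lemma pair_bidirected_digraph_word_graph: "pair_bidirected_digraph (word_graph \<alpha>)"
  by unfold_locales (auto simp: word_graph_def word_edge_def symmetric_def sym_def)

end

theory Submission
  imports Defs
begin

text \<open>
  In an expression with at most \<open>c\<close> labels some subexpression creates a balanced part \<open>A\<close> of the
  vertices (balanced with respect to any chosen set \<open>W\<close>), and vertices of \<open>A\<close> with the same label
  there have the same neighbours outside \<open>A\<close>. Hence at most \<open>c\<close> vertices of \<open>A\<close> are pairwise
  distinguished by vertices outside \<open>A\<close>. Apply this to a grid with few columns and very many rows,
  with \<open>W\<close> the first column. Whatever the letter between two consecutive columns, the rows in which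
  the cut separates these columns yield distinguished vertices, so there are at most \<open>2 * c\<close> of
  them. Therefore some row lies entirely inside \<open>A\<close> and some row entirely outside. Between these two
  rows every letter \<open>2\<close> gives an edge in one fixed direction, and more than \<open>c\<close> letters \<open>2\<close>, far
  enough apart, give more than \<open>c\<close> distinguished vertices.
\<close>

section \<open>Cuts of an expression and their labels\<close>

lemma cw_arcs_subset: "cw_arcs e \<subseteq> cw_verts e \<times> cw_verts e"
  by (induction e) auto

text \<open>
  In the intended instances \<open>A\<close> is the vertex set of a subexpression \<open>f\<close> of \<open>e\<close>, and \<open>l\<close> is
  \<open>cw_label f\<close>. Preservation of label equality makes the condition inductive.
\<close>

definition label_cut :: "'v cw_expr \<Rightarrow> 'v set \<Rightarrow> ('v \<Rightarrow> nat) \<Rightarrow> bool" where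
  "label_cut e A l \<longleftrightarrow> A \<subseteq> cw_verts e \<and> l ` A \<subseteq> cw_labels e \<and>
    (\<forall>u\<in>A. \<forall>v\<in>A. l u = l v \<longrightarrow> cw_label e u = cw_label e v \<and>
      (\<forall>x\<in>cw_verts e - A. (u, x) \<in> cw_arcs e \<longleftrightarrow> (v, x) \<in> cw_arcs e))"

lemma cw_label_in_cw_labels: "v \<in> cw_verts e \<Longrightarrow> cw_label e v \<in> cw_labels e"
  by (induction e) auto

lemma label_cutI:
  assumes "A \<subseteq> cw_verts e" and "l ` A \<subseteq> cw_labels e"
    and "\<And>u v. u \<in> A \<Longrightarrow> v \<in> A \<Longrightarrow> l u = l v \<Longrightarrow> cw_label e u = cw_label e v"
    and "\<And>u v x. u \<in> A \<Longrightarrow> v \<in> A \<Longrightarrow> l u = l v \<Longrightarrow> x \<in> cw_verts e - A \<Longrightarrow>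
      (u, x) \<in> cw_arcs e \<longleftrightarrow> (v, x) \<in> cw_arcs e"
  shows "label_cut e A l"
  unfolding label_cut_def by (intro conjI ballI impI assms)

lemma label_cut_labelD:
  assumes "label_cut e A l" and "u \<in> A" and "v \<in> A" and "l u = l v"
  shows "cw_label e u = cw_label e v"
  using assms unfolding label_cut_def by blast

lemma label_cut_arcD:
  assumes "label_cut e A l" and "u \<in> A" and "v \<in> A" and "l u = l v" and "x \<in> cw_verts e - A"
  shows "(u, x) \<in> cw_arcs e \<longleftrightarrow> (v, x) \<in> cw_arcs e"
  using assms unfolding label_cut_def by blast

lemma label_cut_cw_verts: "label_cut e (cw_verts e) (cw_label e)"
  by (rule label_cutI) (auto simp: cw_label_in_cw_labels)

text \<open>Disjointness keeps the arcs of \<open>f\<close> away from \<open>A\<close>, so labels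
  and arcs at vertices of \<open>A\<close> are those of \<open>e\<close>. An outside vertex lying in
  \<open>f\<close> sees nothing of \<open>A\<close>.\<close>

lemma label_cut_Disj_Union_left:
  assumes cut: "label_cut e A l" and valid: "cw_valid (Disj_Union e f)"
  shows "label_cut (Disj_Union e f) A l"
proof (rule label_cutI)
  have A: "A \<subseteq> cw_verts e" and l: "l ` A \<subseteq> cw_labels e"
    using cut unfolding label_cut_def by blast+
  show "A \<subseteq> cw_verts (Disj_Union e f)" "l ` A \<subseteq> cw_labels (Disj_Union e f)"
    using A l by auto
  have same: "cw_label (Disj_Union e f) u = cw_label e u"
    and arc: "(u, x) \<in> cw_arcs (Disj_Union e f) \<longleftrightarrow> (u, x) \<in> cw_arcs e" if "u \<in> A" for u x
    using that A valid cw_arcs_subset[of f] by auto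
  fix u v
  assume uv: "u \<in> A" "v \<in> A" "l u = l v"
  show "cw_label (Disj_Union e f) u = cw_label (Disj_Union e f) v"
    unfolding same[OF uv(1)] same[OF uv(2)] using cut uv by (rule label_cut_labelD)
  fix x
  assume x: "x \<in> cw_verts (Disj_Union e f) - A"
  show "(u, x) \<in> cw_arcs (Disj_Union e f) \<longleftrightarrow> (v, x) \<in> cw_arcs (Disj_Union e f)"
    unfolding arc[OF uv(1)] arc[OF uv(2)]
  proof (cases "x \<in> cw_verts e")
    case True
    with x show "(u, x) \<in> cw_arcs e \<longleftrightarrow> (v, x) \<in> cw_arcs e"
      using label_cut_arcD[OF cut uv] by blast
  next
    case False
    then show "(u, x) \<in> cw_arcs e \<longleftrightarrow> (v, x) \<in> cw_arcs e"
      using cw_arcs_subset[of e] by blast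
  qed
qed

lemma label_cut_Disj_Union_right:
  assumes cut: "label_cut f A l" and valid: "cw_valid (Disj_Union e f)"
  shows "label_cut (Disj_Union e f) A l"
proof (rule label_cutI)
  have A: "A \<subseteq> cw_verts f" and l: "l ` A \<subseteq> cw_labels f"
    using cut unfolding label_cut_def by blast+
  show "A \<subseteq> cw_verts (Disj_Union e f)" "l ` A \<subseteq> cw_labels (Disj_Union e f)"
    using A l by auto
  have same: "cw_label (Disj_Union e f) u = cw_label f u"
    and arc: "(u, x) \<in> cw_arcs (Disj_Union e f) \<longleftrightarrow> (u, x) \<in> cw_arcs f" if "u \<in> A" for u x
    using that A valid cw_arcs_subset[of e] by auto
  fix u v
  assume uv: "u \<in> A" "v \<in> A" "l u = l v"
  show "cw_label (Disj_Union e f) u = cw_label (Disj_Union e f) v"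
    unfolding same[OF uv(1)] same[OF uv(2)] using cut uv by (rule label_cut_labelD)
  fix x
  assume x: "x \<in> cw_verts (Disj_Union e f) - A"
  show "(u, x) \<in> cw_arcs (Disj_Union e f) \<longleftrightarrow> (v, x) \<in> cw_arcs (Disj_Union e f)"
    unfolding arc[OF uv(1)] arc[OF uv(2)]
  proof (cases "x \<in> cw_verts f")
    case True
    with x show "(u, x) \<in> cw_arcs f \<longleftrightarrow> (v, x) \<in> cw_arcs f"
      using label_cut_arcD[OF cut uv] by blast
  next
    case False
    then show "(u, x) \<in> cw_arcs f \<longleftrightarrow> (v, x) \<in> cw_arcs f"
      using cw_arcs_subset[of f] by blast
  qed
qed

text \<open>Whether \<open>Eta\<close> adds an arc from \<open>u\<close> to \<open>x\<close> depends
  on \<open>u\<close> only through its current label, which agrees for vertices of \<open>A\<close>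
  with the same value of \<open>l\<close>.\<close>

lemma label_cut_Eta:
  assumes cut: "label_cut e A l"
  shows "label_cut (Eta i j e) A l"
proof (rule label_cutI)
  have A: "A \<subseteq> cw_verts e" and l: "l ` A \<subseteq> cw_labels e"
    using cut unfolding label_cut_def by blast+
  show "A \<subseteq> cw_verts (Eta i j e)" "l ` A \<subseteq> cw_labels (Eta i j e)"
    using A l by auto
  fix u v
  assume uv: "u \<in> A" "v \<in> A" "l u = l v"
  have same: "cw_label e u = cw_label e v"
    using cut uv by (rule label_cut_labelD)
  then show "cw_label (Eta i j e) u = cw_label (Eta i j e) v"
    by simp
  have "u \<in> cw_verts e" "v \<in> cw_verts e"
    using A uv by auto
  fix x
  assume "x \<in> cw_verts (Eta i j e) - A"
  then have "(u, x) \<in> cw_arcs e \<longleftrightarrow> (v, x) \<in> cw_arcs e"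
    using label_cut_arcD[OF cut uv] by simp
  with same \<open>u \<in> cw_verts e\<close> \<open>v \<in> cw_verts e\<close>
  show "(u, x) \<in> cw_arcs (Eta i j e) \<longleftrightarrow> (v, x) \<in> cw_arcs (Eta i j e)"
    by simp
qed

lemma label_cut_Rho:
  assumes cut: "label_cut e A l"
  shows "label_cut (Rho i j e) A l"
proof (rule label_cutI)
  show "A \<subseteq> cw_verts (Rho i j e)" "l ` A \<subseteq> cw_labels (Rho i j e)"
    using cut unfolding label_cut_def by auto
  fix u v
  assume uv: "u \<in> A" "v \<in> A" "l u = l v"
  show "cw_label (Rho i j e) u = cw_label (Rho i j e) v"
    using label_cut_labelD[OF cut uv] by simp
  fix x
  assume "x \<in> cw_verts (Rho i j e) - A"
  then show "(u, x) \<in> cw_arcs (Rho i j e) \<longleftrightarrow> (v, x) \<in> cw_arcs (Rho i j e)"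
    using label_cut_arcD[OF cut uv] by simp
qed

text \<open>Descend through the expression, keeping at least \<open>m\<close> vertices of
  \<open>W\<close>. A union holding more than \<open>2 * m\<close> of them has a summand holding at
  least \<open>m\<close>; the descent stops at the latest at a single vertex, where
  \<open>m \<ge> 1\<close> gives the upper bound.\<close>

lemma balanced_label_cut:
  assumes "cw_valid e" and "m \<ge> 1" and "m \<le> card (W \<inter> cw_verts e)"
  shows "\<exists>A l. label_cut e A l \<and> m \<le> card (W \<inter> A) \<and> card (W \<inter> A) \<le> 2 * m"
  using assms(1,3)
proof (induction e)
  case (Create v i)
  have "card (W \<inter> {v}) \<le> card {v}"
    by (intro card_mono) auto
  then have "card (W \<inter> cw_verts (Create v i)) \<le> 2 * m"
    using assms(2) by simp
  then show ?case
    using Create.prems(2) label_cut_cw_verts by (intro exI conjI)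
next
  case (Disj_Union e f)
  show ?case
  proof (cases "card (W \<inter> cw_verts (Disj_Union e f)) \<le> 2 * m")
    case True
    then show ?thesis
      using Disj_Union.prems(2) label_cut_cw_verts by (intro exI conjI)
  next
    case False
    have valid: "cw_valid e" "cw_valid f"
      using Disj_Union.prems(1) by simp_all
    have "card (W \<inter> cw_verts (Disj_Union e f)) \<le> card (W \<inter> cw_verts e) + card (W \<inter> cw_verts f)"
      by (simp add: Int_Un_distrib card_Un_le)
    with False consider "m \<le> card (W \<inter> cw_verts e)" | "m \<le> card (W \<inter> cw_verts f)"
      by linarith
    then show ?thesis
    proof cases
      case 1
      from Disj_Union.IH(1)[OF valid(1) this] show ?thesis
        using label_cut_Disj_Union_left[OF _ Disj_Union.prems(1)] by blast
    next
      case 2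
      from Disj_Union.IH(2)[OF valid(2) this] show ?thesis
        using label_cut_Disj_Union_right[OF _ Disj_Union.prems(1)] by blast
    qed
  qed
next
  case (Eta i j e)
  then have "cw_valid e" "m \<le> card (W \<inter> cw_verts e)"
    by simp_all
  from Eta.IH[OF this] show ?case
    using label_cut_Eta by blast
next
  case (Rho i j e)
  then have "cw_valid e" "m \<le> card (W \<inter> cw_verts e)"
    by simp_all
  from Rho.IH[OF this] show ?case
    using label_cut_Rho by blast
qed

section \<open>Distinguished vertices and clique-width\<close>

text \<open>The vertices of \<open>T\<close> index pairwise different rows of the adjacency matrix
  between \<open>A\<close> and its complement.\<close>

definition distinguished :: "'v pair_pre_digraph \<Rightarrow> 'v set \<Rightarrow> 'v set \<Rightarrow> bool" where
  "distinguished G A T \<longleftrightarrow> T \<subseteq> A \<and>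
    (\<forall>u\<in>T. \<forall>v\<in>T. u \<noteq> v \<longrightarrow>
      (\<exists>x\<in>pverts G - A. ((u, x) \<in> parcs G) \<noteq> ((v, x) \<in> parcs G)))"

text \<open>Equal labels force equal neighbourhoods outside \<open>A\<close>. Hence the labelling of
  a balanced cut in an optimal expression is injective on every distinguished set.\<close>

lemma clique_width_balanced_cut:
  assumes "pair_graph G" and "W \<subseteq> pverts G" and "m \<ge> 1" and "m \<le> card W"
  obtains A where "m \<le> card (W \<inter> A)" and "card (W \<inter> A) \<le> 2 * m"
    and "\<forall>T. distinguished G A T \<longrightarrow> card T \<le> clique_width G"
proof -
  have ne: "pverts G \<noteq> {}"
    using assms by auto
  have "\<exists>k e. cw_valid e \<and> cw_graph e = G \<and> card (cw_labels e) = k"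
    using cw_expr_exists[OF assms(1) ne] by auto
  from LeastI_ex[OF this] obtain e where e: "cw_valid e" "cw_graph e = G"
      "card (cw_labels e) = clique_width G"
    using ne by (auto simp: clique_width_def)
  have G: "pverts G = cw_verts e" "parcs G = cw_arcs e"
    using e(2) by (auto simp: cw_graph_def)
  have "W \<inter> cw_verts e = W"
    using assms(2) G by auto
  then obtain A l where A: "label_cut e A l" "m \<le> card (W \<inter> A)" "card (W \<inter> A) \<le> 2 * m"
    using balanced_label_cut[OF e(1) assms(3), of W] assms(4) by auto
  have "card T \<le> clique_width G" if T: "distinguished G A T" for T
  proof -
    have "inj_on l T"
    proof (rule inj_onI, rule ccontr)
      fix u v
      assume uv: "u \<in> T" "v \<in> T" "l u = l v" "u \<noteq> v"
      then obtain x where "x \<in> cw_verts e - A" "((u, x) \<in> cw_arcs e) \<noteq> ((v, x) \<in> cw_arcs e)"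
        using T unfolding distinguished_def G by blast
      moreover have "u \<in> A" "v \<in> A"
        using T uv unfolding distinguished_def by blast+
      ultimately show False
        using label_cut_arcD[OF A(1) _ _ uv(3)] by blast
    qed
    moreover have "l ` T \<subseteq> cw_labels e"
      using T A(1) unfolding distinguished_def label_cut_def by blast
    ultimately show ?thesis
      using card_inj_on_le[OF _ _ finite_cw_labels] e(3) by fastforce
  qed
  with A show ?thesis
    using that by blast
qed

section \<open>Finite grids in the class\<close>

definition word_grid :: "(nat \<Rightarrow> nat) \<Rightarrow> nat \<Rightarrow> nat \<Rightarrow> (nat \<times> nat) pair_pre_digraph" where
  "word_grid \<alpha> R M =
    \<lparr>pverts = {1..R} \<times> {1..M},
     parcs = {(u, v). u \<in> {1..R} \<times> {1..M} \<and> v \<in> {1..R} \<times> {1..M} \<and>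
       (word_edge \<alpha> u v \<or> word_edge \<alpha> v u)}\<rparr>"

lemma pverts_word_grid [simp]: "pverts (word_grid \<alpha> R M) = {1..R} \<times> {1..M}"
  by (simp add: word_grid_def)

lemma parcs_word_grid:
  "(u, v) \<in> parcs (word_grid \<alpha> R M) \<longleftrightarrow> u \<in> {1..R} \<times> {1..M} \<and> v \<in> {1..R} \<times> {1..M} \<and>
    (word_edge \<alpha> u v \<or> word_edge \<alpha> v u)"
  by (auto simp: word_grid_def)

lemma pair_graph_word_grid: "pair_graph (word_grid \<alpha> R M)"
proof -
  have "finite (parcs (word_grid \<alpha> R M))"
    by (rule finite_subset[of _ "({1..R} \<times> {1..M}) \<times> ({1..R} \<times> {1..M})"])
      (auto simp: word_grid_def)
  then show ?thesis
    by unfold_locales (auto simp: word_grid_def word_edge_def symmetric_def sym_def)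
qed

lemma word_grid_in_word_class: "word_grid \<alpha> R M \<in> word_class \<alpha>"
proof -
  interpret H: pair_graph "word_grid \<alpha> R M"
    by (rule pair_graph_word_grid)
  interpret P: pair_bidirected_digraph "word_graph \<alpha>"
    by (rule pair_bidirected_digraph_word_graph)
  have "induced_subgraph (with_proj (word_grid \<alpha> R M)) (with_proj (word_graph \<alpha>))"
    using H.wf_digraph P.wf_digraph
    by (intro induced_subgraphI subgraphI) (auto simp: word_grid_def word_graph_def)
  moreover have "digraph_iso (with_proj (word_grid \<alpha> R M)) (with_proj (word_grid \<alpha> R M))"
    unfolding digraph_iso_def
    \<comment> \<open>The last two fields are the projections of the image graph, which are those of
      \<open>with_proj\<close>.\<close>
    by (rule exI[of _ "\<lparr>iso_verts = id, iso_arcs = id, iso_head = snd, iso_tail = fst\<rparr>"])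
      (use H.wf_digraph in \<open>simp add: pre_digraph.digraph_isomorphism_def app_iso_def with_proj_def\<close>)
  ultimately show ?thesis
    by (auto simp: word_class_def intro!: exI[of _ "word_grid \<alpha> R M"])
qed

section \<open>Rows of a grid with respect to a cut\<close>

lemma card_separated_rows_le:
  assumes \<alpha>: "\<alpha> j \<in> {0, 1, 2}" and j: "1 \<le> j" "j < M"
    and cut: "\<And>T. distinguished (word_grid \<alpha> R M) A T \<Longrightarrow> card T \<le> c"
  shows "card {i \<in> {1..R}. ((i, j) \<in> A) \<noteq> ((i, j + 1) \<in> A)} \<le> 2 * c"
proof -
  let ?G = "word_grid \<alpha> R M"
  define I where "I = {i \<in> {1..R}. (i, j) \<in> A \<and> (i, j + 1) \<notin> A}"
  define J where "J = {i \<in> {1..R}. (i, j) \<notin> A \<and> (i, j + 1) \<in> A}"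
  have "\<exists>x\<in>pverts ?G - A. (((i, j), x) \<in> parcs ?G) \<noteq> (((k, j), x) \<in> parcs ?G)"
    if "i \<in> I" "k \<in> I" "i < k" for i k
    \<comment> \<open>The witness lies in the smaller row: for the letter 2 it is adjacent to
      \<open>(i, j)\<close> but not to \<open>(k, j)\<close>. Letters 0 and 1 also tell row
      \<open>i\<close> from row \<open>k\<close>.\<close>
    using that \<alpha> j by (intro bexI[of _ "(i, j + 1)"]) (auto simp: I_def parcs_word_grid word_edge_def)
  then have "distinguished ?G A ((\<lambda>i. (i, j)) ` I)"
    by (force simp: distinguished_def I_def neq_iff)
  then have "card ((\<lambda>i. (i, j)) ` I) \<le> c"
    by (rule cut)
  then have I: "card I \<le> c"
    by (simp add: card_image inj_on_def)
  have "\<exists>x\<in>pverts ?G - A. (((i, j + 1), x) \<in> parcs ?G) \<noteq> (((k, j + 1), x) \<in> parcs ?G)"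
    if "i \<in> J" "k \<in> J" "i < k" for i k
    \<comment> \<open>Seen from the right column the order reverses, so the witness lies in the
      larger row.\<close>
    using that \<alpha> j by (intro bexI[of _ "(k, j)"]) (auto simp: J_def parcs_word_grid word_edge_def)
  then have "distinguished ?G A ((\<lambda>i. (i, j + 1)) ` J)"
    by (force simp: distinguished_def J_def neq_iff)
  then have "card ((\<lambda>i. (i, j + 1)) ` J) \<le> c"
    by (rule cut)
  then have J: "card J \<le> c"
    by (simp add: card_image inj_on_def)
  have "{i \<in> {1..R}. ((i, j) \<in> A) \<noteq> ((i, j + 1) \<in> A)} = I \<union> J"
    by (auto simp: I_def J_def)
  then show ?thesis
    using I J card_Un_le[of I J] by simp
qed

text \<open>Each of the fewer than \<open>M\<close> pairs of consecutive columns separates at most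
  \<open>2 * c\<close> rows, too few to cover \<open>X\<close>. A row of \<open>X\<close> that is
  never separated stays on the side of its first vertex.\<close>

lemma ex_unseparated_row:
  assumes \<alpha>: "\<forall>j\<ge>1. \<alpha> j \<in> {0, 1, 2}"
    and cut: "\<And>T. distinguished (word_grid \<alpha> R M) A T \<Longrightarrow> card T \<le> c"
    and X: "X \<subseteq> {1..R}" "card X > 2 * c * M"
  shows "\<exists>i\<in>X. \<forall>j\<in>{1..M}. (i, j) \<in> A \<longleftrightarrow> (i, 1) \<in> A"
proof -
  define D where "D j = {i \<in> {1..R}. ((i, j) \<in> A) \<noteq> ((i, j + 1) \<in> A)}" for j
  have "card (\<Union>j\<in>{1..<M}. D j) \<le> (\<Sum>j\<in>{1..<M}. card (D j))"
    by (rule card_UN_le) simp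
  also have "\<dots> \<le> (\<Sum>j\<in>{1..<M}. 2 * c)"
    unfolding D_def by (intro sum_mono card_separated_rows_le cut) (use \<alpha> in auto)
  also have "\<dots> \<le> 2 * c * M"
    by simp
  also have "\<dots> < card X"
    by (rule X)
  finally have "\<not> X \<subseteq> (\<Union>j\<in>{1..<M}. D j)"
    using card_mono[of "\<Union>j\<in>{1..<M}. D j" X] by (auto simp: D_def)
  then obtain i where i: "i \<in> X" "\<forall>j\<in>{1..<M}. i \<notin> D j"
    by auto
  have "(i, j) \<in> A \<longleftrightarrow> (i, 1) \<in> A" if "1 \<le> j" "j \<le> M" for j
    using that
  proof (induction j rule: nat_induct_at_least)
    case (Suc j)
    have "i \<notin> D j" "i \<in> {1..R}"
      using i X(1) Suc.prems Suc.hyps by auto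
    then have "(i, j) \<in> A \<longleftrightarrow> (i, Suc j) \<in> A"
      unfolding D_def Suc_eq_plus1 by blast
    then show ?case
      using Suc.IH Suc.prems by simp
  qed simp
  with i(1) show ?thesis
    by (intro bexI[of _ i] ballI) (simp_all only: atLeastAtMost_iff)
qed

text \<open>Each letter 2 joins the smaller of the two rows to the larger one in the next column.
  This gives each chosen vertex of row \<open>a\<close> a private neighbour in row \<open>b\<close>:
  another chosen vertex could see it only across a column difference excluded by
  \<open>gap\<close>.\<close>

lemma two_constant_rows_distinguished:
  assumes two: "\<And>s. s \<le> c \<Longrightarrow> \<alpha> (p s) = 2 \<and> 1 \<le> p s \<and> p s < M"
    and inj: "inj_on p {..c}"
    and gap: "\<And>s t. p s \<noteq> p t + 2"
    and a: "a \<in> {1..R}" "\<forall>j\<in>{1..M}. (a, j) \<in> A"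
    and b: "b \<in> {1..R}" "\<forall>j\<in>{1..M}. (b, j) \<notin> A"
  shows "\<exists>T. distinguished (word_grid \<alpha> R M) A T \<and> card T = c + 1"
proof -
  let ?G = "word_grid \<alpha> R M"
  \<comment> \<open>The position \<open>p 0\<close> ensures that there is a column in which to
    compare the rows.\<close>
  have "a \<noteq> b"
    using a b two[of 0] by force
  then consider "a < b" | "b < a"
    by linarith
  then show ?thesis
  proof cases
    case 1
    have "\<exists>x\<in>pverts ?G - A. (((a, p s), x) \<in> parcs ?G) \<noteq> (((a, p t), x) \<in> parcs ?G)"
      if "s \<le> c" "t \<le> c" "p s \<noteq> p t" for s t
      using that 1 a b two[of s] two[of t] gap[of s t] gap[of t s]
      by (intro bexI[of _ "(b, p s + 1)"]) (auto simp: parcs_word_grid word_edge_def)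
    moreover have "(a, p s) \<in> A" if "s \<le> c" for s
      using a two[OF that] by auto
    ultimately have "distinguished ?G A ((\<lambda>s. (a, p s)) ` {..c})"
      by (auto simp: distinguished_def)
    moreover have "card ((\<lambda>s. (a, p s)) ` {..c}) = c + 1"
      using inj by (subst card_image) (auto simp: inj_on_def)
    ultimately show ?thesis
      by blast
  next
    case 2
    have "\<exists>x\<in>pverts ?G - A. (((a, p s + 1), x) \<in> parcs ?G) \<noteq> (((a, p t + 1), x) \<in> parcs ?G)"
      if "s \<le> c" "t \<le> c" "p s \<noteq> p t" for s t
      using that 2 a b two[of s] two[of t] gap[of s t] gap[of t s]
      by (intro bexI[of _ "(b, p s)"]) (auto simp: parcs_word_grid word_edge_def)
    moreover have "(a, p s + 1) \<in> A" if "s \<le> c" for s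
      using a two[OF that] by auto
    ultimately have "distinguished ?G A ((\<lambda>s. (a, p s + 1)) ` {..c})"
      by (auto simp: distinguished_def)
    moreover have "card ((\<lambda>s. (a, p s + 1)) ` {..c}) = c + 1"
      using inj by (subst card_image) (auto simp: inj_on_def)
    ultimately show ?thesis
      by blast
  qed
qed

section \<open>Spaced letters 2 and the choice of the grid\<close>

text \<open>Taking every third element of \<open>S\<close> makes distinct terms differ by at least
  3.\<close>

lemma infinite_nat_spaced_sequence:
  fixes S :: "nat set"
  assumes "infinite S"
  obtains p :: "nat \<Rightarrow> nat" where "strict_mono p" and "\<forall>s. p s \<in> S" and "\<forall>s t. p s \<noteq> p t + 2"
proof (rule that[of "\<lambda>s. enumerate S (3 * s)"])
  let ?p = "\<lambda>s. enumerate S (3 * s)"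
  have mono: "strict_mono (enumerate S)"
    using assms by (rule strict_mono_enumerate)
  show sm: "strict_mono ?p"
    using mono by (auto simp: strict_mono_def)
  show "\<forall>s. ?p s \<in> S"
    using assms by (simp add: enumerate_in_set)
  have "?p s \<noteq> ?p t + 2" for s t
  proof (cases "s \<le> t")
    case True
    then have "?p s \<le> ?p t"
      using mono by (simp add: strict_mono_less_eq)
    then show ?thesis
      by simp
  next
    case False
    have step: "enumerate S n < enumerate S (Suc n)" for n
      using assms by (rule enumerate_step)
    have "enumerate S (3 * t + 3) \<le> ?p s"
      using False mono by (simp add: strict_mono_less_eq)
    then show ?thesis
      using step[of "3 * t"] step[of "3 * t + 1"] step[of "3 * t + 2"]
      by (simp add: numeral_3_eq_3)
  qed
  then show "\<forall>s t. ?p s \<noteq> ?p t + 2"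
    by blast
qed

theorem lemma9:
  fixes \<alpha> :: "nat \<Rightarrow> nat"
  assumes "\<forall>j\<ge>1. \<alpha> j \<in> {0, 1, 2}"
    and "infinite {j. j \<ge> 1 \<and> \<alpha> j = 2}"
  shows "\<not> (\<exists>c::nat. \<forall>G \<in> word_class \<alpha>. clique_width G \<le> c)"
proof
  assume "\<exists>c. \<forall>G \<in> word_class \<alpha>. clique_width G \<le> c"
  then obtain c where c: "\<And>G. G \<in> word_class \<alpha> \<Longrightarrow> clique_width G \<le> c"
    by blast
  obtain p :: "nat \<Rightarrow> nat" where p: "strict_mono p" "\<forall>s. p s \<in> {j. j \<ge> 1 \<and> \<alpha> j = 2}" "\<forall>s t. p s \<noteq> p t + 2"
    using infinite_nat_spaced_sequence[OF assms(2)] by blast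
  \<comment> \<open>The columns contain the letters at \<open>p 0\<close> to \<open>p c\<close> and
    the column after each. As between \<open>m\<close> and \<open>2 * m\<close> of the
    \<open>3 * m\<close> rows start in \<open>A\<close>, at least \<open>m\<close> rows start on
    either side, enough for \<open>ex_unseparated_row\<close>.\<close>
  define M where "M = p c + 1"
  define m where "m = 2 * c * M + 1"
  define R where "R = 3 * m"
  let ?G = "word_grid \<alpha> R M" and ?W = "{1..R} \<times> {1::nat}"
  have W: "?W \<subseteq> pverts ?G" "1 \<le> m" "m \<le> card ?W"
    by (auto simp: M_def R_def m_def)
  obtain A where A: "m \<le> card (?W \<inter> A)" "card (?W \<inter> A) \<le> 2 * m"
    and "\<forall>T. distinguished ?G A T \<longrightarrow> card T \<le> clique_width ?G"
    using clique_width_balanced_cut[OF pair_graph_word_grid W] by blast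
  then have cut: "card T \<le> c" if "distinguished ?G A T" for T
    using that c[OF word_grid_in_word_class] order_trans by blast
  define X where "X = {i \<in> {1..R}. (i, 1) \<in> A}"
  have X: "X \<subseteq> {1..R}"
    by (auto simp: X_def)
  have "?W \<inter> A = (\<lambda>i. (i, 1)) ` X"
    by (auto simp: X_def)
  then have card_X: "card (?W \<inter> A) = card X"
    by (simp add: card_image inj_on_def)
  have "card ({1..R} - X) = R - card X"
    using X by (simp add: card_Diff_subset finite_subset)
  then have large: "card X > 2 * c * M" "card ({1..R} - X) > 2 * c * M"
    using A card_X by (auto simp: R_def m_def)
  obtain a where a: "a \<in> X" "\<forall>j\<in>{1..M}. (a, j) \<in> A \<longleftrightarrow> (a, 1) \<in> A"
    using ex_unseparated_row[OF assms(1) cut X large(1)] by blast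
  obtain b where b: "b \<in> {1..R} - X" "\<forall>j\<in>{1..M}. (b, j) \<in> A \<longleftrightarrow> (b, 1) \<in> A"
    using ex_unseparated_row[OF assms(1) cut Diff_subset large(2)] by blast
  have two: "\<alpha> (p s) = 2 \<and> 1 \<le> p s \<and> p s < M" if "s \<le> c" for s
    using p(1) p(2)[rule_format, of s] that by (simp add: M_def less_Suc_eq_le strict_mono_less_eq)
  have inj: "inj_on p {..c}"
    using p(1) by (auto intro: inj_on_subset[OF strict_mono_imp_inj_on])
  have "a \<in> {1..R}" "\<forall>j\<in>{1..M}. (a, j) \<in> A" "b \<in> {1..R}" "\<forall>j\<in>{1..M}. (b, j) \<notin> A"
    using a b unfolding X_def by blast+
  then obtain T where "distinguished ?G A T" "card T = c + 1"
    using two_constant_rows_distinguished[OF two inj p(3)[rule_format]] by blast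
  then show False
    using cut[of T] by simp
qed

end
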